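(* The schedulability test of federated scheduling with the long-paths response time bound $$R\le \min_{j\in[0,k]}\left\{len(G)+\frac{vol(G)-\sum_{i=0}^{j}len(\lambda_i)}{m-j}\right\}$$ dominates the original schedulability test of federated scheduling, which uses Graham's bound $$R\le len(G)+\frac{vol(G)-len(G)}{m}.$$
   Context: **Tasks.** A system consists of several sporadic parallel tasks. Each is a DAG $G=(V,E)$ with one source and one sink, whose vertices $v$ have worst-case execution times (WCETs) $c(v)$ and whose edges are precedence constraints, together with a relative deadline $D$ and a period $T$, with $D\le T$. The length of a path (or of a set of vertices) is the sum of $c(v)$ over its vertices. Write $C=vol(G)=\sum_{v\in V}c(v)$ and let $L=len(G)$ be the length of the longest path of $G$ (a source-to-sink path of maximal length); it is assumed that $L\le D$. A task is heavy if $C\ge D$ and light if $C<D$. $R$ denotes the response time of $G$ when executed on $m$ identical cores by a work-conserving scheduler (a vertex all of whose predecessors have finished must be executed if a core is available). **The lists $(\lambda_i)$ and $(L_i)$.** These are computed by the following algorithm. Start with $G'=G$, $i=0$. While $vol(G')\ne 0$: let $\lambda_i$ be the longest path of $G'$; delete from $\lambda_i$ the vertices whose WCET in $G'$ is $0$; set the WCETs in $G'$ of all vertices of $\lambda_i$ to $0$; increment $i$. The result is $(\lambda_i)_0^{\bar k}$, a list of pairwise disjoint vertex sequences, where $\bar k+1$ is the number of iterations and $\lambda_0$ is the longest path of $G$. Put $L_i=len(\lambda_i)$, so $L_0=L$ and $\sum_{i=0}^{\bar k}L_i=C$. In the long-paths bound, $k=\min(\bar k,m-1)$. **Federated scheduling.**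 Each heavy task is assigned, and executes exclusively on, a number $m$ of dedicated cores under a work-conserving scheduler. Light tasks are treated as sequential sporadic tasks and scheduled on the remaining cores by a sequential multiprocessor scheduling algorithm such as global EDF or partitioned EDF. The two tests compared differ only in the number of cores $m$ assigned to each heavy task: - Original test (Graham's bound): $m=\left\lceil\frac{C-L}{D-L}\right\rceil$. - New test (long-paths bound): $m=\min_{j\in[0,\bar k]}\{m(j)\}$, where $$m(j)=\begin{cases}\left\lceil\frac{C-\sum_{i=0}^{j}L_i}{D-L}\right\rceil+j & j<\bar k \text{ and } D>L,\\ \bar k+1 & j=\bar k.\end{cases}$$ "Dominates" is the standard term of schedulability analysis: one test dominates another if every task system deemed schedulable by the second is also deemed schedulable by the first.
   Formalization: Adds the assumption that light tasks accepted on some number of cores are also accepted on more cores (the claim fails otherwise); where D = L leaves the original test's quotient undefined, Graham's bound is applied directly (1 core if C = L, otherwise none suffices). *)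

theory Defs
  imports
    Complex_Main
    "HOL-Library.Extended_Nat"
    "Graph_Theory.Pair_Digraph"
    "Graph_Theory.Vertex_Walk"
begin

record 'v dag_task =
  dag :: "'v pair_pre_digraph"
  wcet :: "'v \<Rightarrow> real"
  deadline :: real
  period :: real

definition is_source :: "'v pair_pre_digraph \<Rightarrow> 'v \<Rightarrow> bool" where
  "is_source G v \<longleftrightarrow> v \<in> pverts G \<and> in_arcs (with_proj G) v = {}"

definition is_sink :: "'v pair_pre_digraph \<Rightarrow> 'v \<Rightarrow> bool" where
  "is_sink G v \<longleftrightarrow> v \<in> pverts G \<and> out_arcs (with_proj G) v = {}"

definition complete_path :: "'v pair_pre_digraph \<Rightarrow> 'v list \<Rightarrow> bool" where
  "complete_path G p \<longleftrightarrow> vwalk p (with_proj G) \<and> is_source G (hd p) \<and> is_sink G (last p)"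

(* The graphs below are acyclic, so a path visits no vertex twice. *)
definition path_len :: "('v \<Rightarrow> real) \<Rightarrow> 'v list \<Rightarrow> real" where
  "path_len c p = (\<Sum>v\<in>set p. c v)"

definition vol :: "'v pair_pre_digraph \<Rightarrow> ('v \<Rightarrow> real) \<Rightarrow> real" where
  "vol G c = (\<Sum>v\<in>pverts G. c v)"

definition len :: "'v pair_pre_digraph \<Rightarrow> ('v \<Rightarrow> real) \<Rightarrow> real" where
  "len G c = Max {path_len c p |p. complete_path G p}"

definition longest_path :: "'v pair_pre_digraph \<Rightarrow> ('v \<Rightarrow> real) \<Rightarrow> 'v list \<Rightarrow> bool" where
  "longest_path G c p \<longleftrightarrow>
     complete_path G p \<and> (\<forall>q. complete_path G q \<longrightarrow> path_len c q \<le> path_len c p)"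

definition task_vol :: "'v dag_task \<Rightarrow> real" where
  "task_vol \<tau> = vol (dag \<tau>) (wcet \<tau>)"

definition task_len :: "'v dag_task \<Rightarrow> real" where
  "task_len \<tau> = len (dag \<tau>) (wcet \<tau>)"

definition valid_task :: "'v dag_task \<Rightarrow> bool" where
  "valid_task \<tau> \<longleftrightarrow>
     pair_fin_digraph (dag \<tau>) \<and> acyclic (parcs (dag \<tau>)) \<and>
     (\<exists>!v. is_source (dag \<tau>) v) \<and> (\<exists>!v. is_sink (dag \<tau>) v) \<and>
     (\<forall>v\<in>pverts (dag \<tau>). 0 \<le> wcet \<tau> v) \<and>
     0 < deadline \<tau> \<and> deadline \<tau> \<le> period \<tau> \<and>
     task_len \<tau> \<le> deadline \<tau>"

definition heavy :: "'v dag_task \<Rightarrow> bool" where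
  "heavy \<tau> \<longleftrightarrow> deadline \<tau> \<le> task_vol \<tau>"

(* long_paths G c ps: some run of the path-peeling algorithm on G with WCETs c outputs ps.
   It is a relation because a longest path need not be unique. *)
inductive long_paths :: "'v pair_pre_digraph \<Rightarrow> ('v \<Rightarrow> real) \<Rightarrow> 'v list list \<Rightarrow> bool"
  for G where
  stop: "vol G c = 0 \<Longrightarrow> long_paths G c []"
| peel: "\<lbrakk>vol G c \<noteq> 0; longest_path G c p; q = filter (\<lambda>v. c v \<noteq> 0) p;
          long_paths G (\<lambda>v. if v \<in> set q then 0 else c v) qs\<rbrakk>
         \<Longrightarrow> long_paths G c (q # qs)"

(* For D = L the quotient in Graham's test is undefined, and we fall back on the bound
   L + (C - L) / m \<le> D itself: it holds for every m \<ge> 1 if C = L and for no m otherwise.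
   The value \<infinity> means that no number of cores is sufficient. *)
definition graham_cores :: "'v dag_task \<Rightarrow> enat" where
  "graham_cores \<tau> =
     (let C = task_vol \<tau>; L = task_len \<tau>; D = deadline \<tau> in
      if L < D then enat (nat \<lceil>(C - L) / (D - L)\<rceil>)
      else if C = L then 1 else \<infinity>)"

(* The value \<infinity> marks the case j < k, D = L, in which m(j) is undefined and so
   does not take part in the minimum. *)
definition long_paths_cores_at :: "'v dag_task \<Rightarrow> 'v list list \<Rightarrow> nat \<Rightarrow> enat" where
  "long_paths_cores_at \<tau> ps j =
     (let C = task_vol \<tau>; L = task_len \<tau>; D = deadline \<tau>; k = length ps - 1 in
      if j = k then enat (k + 1)
      else if L < D
        then enat (nat \<lceil>(C - (\<Sum>i=0..j. path_len (wcet \<tau>) (ps ! i))) / (D - L)\<rceil> + j)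
      else \<infinity>)"

definition long_paths_cores :: "'v dag_task \<Rightarrow> 'v list list \<Rightarrow> enat" where
  "long_paths_cores \<tau> ps = Min (long_paths_cores_at \<tau> ps ` {0..length ps - 1})"

record seq_task =
  seq_wcet :: real
  seq_deadline :: real
  seq_period :: real

definition as_sequential :: "'v dag_task \<Rightarrow> seq_task" where
  "as_sequential \<tau> =
     \<lparr>seq_wcet = task_vol \<tau>, seq_deadline = deadline \<tau>, seq_period = period \<tau>\<rparr>"

(* cores \<tau>: number of cores dedicated to the heavy task \<tau>;
   S n ts: the sequential multiprocessor algorithm schedules ts on n cores;
   M: number of cores of the platform. *)
definition federated_test ::
  "('v dag_task \<Rightarrow> enat) \<Rightarrow> (nat \<Rightarrow> seq_task list \<Rightarrow> bool) \<Rightarrow> nat \<Rightarrow> 'v dag_task list \<Rightarrow> bool" where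
  "federated_test cores S M ts \<longleftrightarrow>
     (let h = (\<Sum>\<tau>\<leftarrow>filter heavy ts. cores \<tau>) in
      h \<le> enat M \<and>
      S (M - the_enat h) (map as_sequential (filter (\<lambda>\<tau>. \<not> heavy \<tau>) ts)))"

definition original_test ::
  "(nat \<Rightarrow> seq_task list \<Rightarrow> bool) \<Rightarrow> nat \<Rightarrow> 'v dag_task list \<Rightarrow> bool" where
  "original_test S M ts = federated_test graham_cores S M ts"

(* \<Lambda> \<tau> is the list of long paths computed for \<tau>. *)
definition long_paths_test ::
  "('v dag_task \<Rightarrow> 'v list list) \<Rightarrow> (nat \<Rightarrow> seq_task list \<Rightarrow> bool) \<Rightarrow> nat
    \<Rightarrow> 'v dag_task list \<Rightarrow> bool" where
  "long_paths_test \<Lambda> S M ts = federated_test (\<lambda>\<tau>. long_paths_cores \<tau> (\<Lambda> \<tau>)) S M ts"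

definition test_dominates ::
  "('v dag_task list \<Rightarrow> bool) \<Rightarrow> ('v dag_task list \<Rightarrow> bool) \<Rightarrow> bool" where
  "test_dominates A B \<longleftrightarrow> (\<forall>ts. (\<forall>\<tau>\<in>set ts. valid_task \<tau>) \<longrightarrow> B ts \<longrightarrow> A ts)"

end

theory Submission
  imports Defs
begin

text \<open>For a heavy task with at least two long paths and \<open>D > L\<close>, \<open>j = 0\<close> takes part in the
  minimum and, as \<open>L\<^sub>0 = L\<close>, \<open>m(0)\<close> is Graham's number of cores; if \<open>D = L\<close>, then
  \<open>C > L\<close> and Graham's bound admits no number of cores. If there is only one long path, then
  \<open>C = L\<close>, so \<open>D \<le> C = L \<le> D\<close> by heaviness, and both tests assign one core. Thus no heavy
  task gets more cores than before, and the light tasks keep at least as many.\<close>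

lemma complete_path_subset_pverts: "complete_path G p \<Longrightarrow> set p \<subseteq> pverts G"
  by (auto simp: complete_path_def vwalk_def)

lemma len_eq_longest_path:
  assumes fin: "finite (pverts G)" and p: "longest_path G c p"
  shows "len G c = path_len c p"
proof -
  \<comment> \<open>\<open>Max\<close> needs a finite set, but without acyclicity there may be
    infinitely many walks. Their lengths are still sums over subsets of the finite vertex
    set.\<close>
  have "{path_len c q |q. complete_path G q} \<subseteq> sum c ` Pow (pverts G)"
    using complete_path_subset_pverts by (fastforce simp: path_len_def)
  then have "finite {path_len c q |q. complete_path G q}"
    using fin by (meson finite_Pow_iff finite_imageI finite_subset)
  then show ?thesis
    unfolding len_def using p by (intro Max_eqI) (auto simp: longest_path_def)
qed

lemma path_len_filter_nonzero: "path_len c (filter (\<lambda>v. c v \<noteq> 0) p) = path_len c p"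
  unfolding path_len_def by (intro sum.mono_neutral_left) auto

text \<open>Applied to the vertices of a peeled path, this gives the volume left for the rest of the
  run.\<close>

lemma vol_zero_on:
  assumes "finite (pverts G)" "A \<subseteq> pverts G"
  shows "vol G (\<lambda>v. if v \<in> A then 0 else c v) = vol G c - sum c A"
proof -
  have "vol G (\<lambda>v. if v \<in> A then 0 else c v) = sum c (pverts G - A)"
    unfolding vol_def using assms by (intro sum.mono_neutral_cong_right) auto
  also have "\<dots> = vol G c - sum c A"
    unfolding vol_def using assms by (simp add: sum_diff)
  finally show ?thesis .
qed

lemma long_paths_Nil_iff: "long_paths G c ps \<Longrightarrow> ps = [] \<longleftrightarrow> vol G c = 0"
  by (auto elim: long_paths.cases)

text \<open>The filter drops only vertices of WCET 0, so \<open>q\<close> is as long as the longest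
  path it comes from. Peeling it lowers the volume by exactly that length, and the run stops once no
  volume is left.\<close>

lemma long_paths_Cons:
  assumes fin: "finite (pverts G)" and lp: "long_paths G c (q # qs)"
  shows "path_len c q = len G c" and "qs = [] \<longleftrightarrow> vol G c = len G c"
proof -
  obtain p where p: "longest_path G c p" and q: "q = filter (\<lambda>v. c v \<noteq> 0) p"
    and qs: "long_paths G (\<lambda>v. if v \<in> set q then 0 else c v) qs"
    using lp by (auto elim: long_paths.cases)
  show len: "path_len c q = len G c"
    using len_eq_longest_path[OF fin p] by (simp add: q path_len_filter_nonzero)
  have "set q \<subseteq> pverts G"
    using p complete_path_subset_pverts by (fastforce simp: q longest_path_def)
  then show "qs = [] \<longleftrightarrow> vol G c = len G c"
    using long_paths_Nil_iff[OF qs] vol_zero_on[OF fin, of "set q" c] len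
    by (simp add: path_len_def)
qed

lemma long_paths_cores_le:
  "j \<le> length ps - 1 \<Longrightarrow> long_paths_cores \<tau> ps \<le> long_paths_cores_at \<tau> ps j"
  unfolding long_paths_cores_def by (intro Min_le) auto

lemma long_paths_cores_le_graham_cores:
  assumes valid: "valid_task \<tau>" and "heavy \<tau>"
    and ps: "long_paths (dag \<tau>) (wcet \<tau>) ps"
  shows "long_paths_cores \<tau> ps \<le> graham_cores \<tau>"
proof -
  interpret pair_fin_digraph "dag \<tau>"
    using valid by (simp add: valid_task_def)
  have D: "0 < deadline \<tau>" "task_len \<tau> \<le> deadline \<tau>" "deadline \<tau> \<le> task_vol \<tau>"
    using assms by (auto simp: valid_task_def heavy_def)
  \<comment> \<open>By heaviness C >= D > 0, so at least one path is peeled and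
    \<open>ps ! 0\<close> exists.\<close>
  then have "ps \<noteq> []"
    using long_paths_Nil_iff[OF ps] by (auto simp: task_vol_def)
  then obtain q qs where q: "ps = q # qs"
    by (cases ps) auto
  note Cons = long_paths_Cons[OF pair_finite_verts ps[unfolded q]]
  \<comment> \<open>Index 0 is the last one iff \<open>qs = []\<close>, that is, iff C = L; then D =
    L and \<open>graham_cores\<close> takes its fallback value 1. Otherwise the sum over
    \<open>{0..0}\<close> is just L.\<close>
  have "long_paths_cores_at \<tau> ps 0 \<le> graham_cores \<tau>"
    using Cons D unfolding q long_paths_cores_at_def graham_cores_def
    by (auto simp: task_vol_def task_len_def Let_def one_enat_def)
  then show ?thesis
    using long_paths_cores_le[of 0 ps \<tau>] by simp
qed

text \<open>Cores that heavy tasks no longer claim pass to the light tasks, and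
  \<open>more_cores\<close> says that extra cores never harm \<open>S\<close>.\<close>

lemma federated_test_mono:
  assumes "federated_test f S M ts"
    and le: "\<And>\<tau>. \<tau> \<in> set ts \<Longrightarrow> heavy \<tau> \<Longrightarrow> g \<tau> \<le> f \<tau>"
    and more_cores: "\<And>n n' ts. S n ts \<Longrightarrow> n \<le> n' \<Longrightarrow> S n' ts"
  shows "federated_test g S M ts"
proof -
  define hf where "hf = (\<Sum>\<tau>\<leftarrow>filter heavy ts. f \<tau>)"
  define hg where "hg = (\<Sum>\<tau>\<leftarrow>filter heavy ts. g \<tau>)"
  have "hg \<le> hf"
    unfolding hf_def hg_def using le by (intro sum_list_mono) auto
  moreover have hf: "hf \<le> enat M"
    and S: "S (M - the_enat hf) (map as_sequential (filter (\<lambda>\<tau>. \<not> heavy \<tau>) ts))"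
    using assms(1) by (auto simp: federated_test_def hf_def Let_def)
  \<comment> \<open>The bound by \<open>enat M\<close> makes both sums finite;
    \<open>the_enat\<close> is unspecified at \<open>\<infinity>\<close>, so it is monotone only
    there.\<close>
  ultimately have "hg \<le> enat M" and "the_enat hg \<le> the_enat hf"
    by (cases hf; cases hg; simp)+
  moreover have "S (M - the_enat hg) (map as_sequential (filter (\<lambda>\<tau>. \<not> heavy \<tau>) ts))"
    using S \<open>the_enat hg \<le> the_enat hf\<close> by (rule more_cores[OF _ diff_le_mono2])
  ultimately show ?thesis
    by (simp add: federated_test_def hg_def Let_def)
qed

theorem corollary2:
  fixes \<Lambda> :: "'v dag_task \<Rightarrow> 'v list list"
    and S :: "nat \<Rightarrow> seq_task list \<Rightarrow> bool"
    and M :: nat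
  assumes paths: "\<And>\<tau>. valid_task \<tau> \<Longrightarrow> long_paths (dag \<tau>) (wcet \<tau>) (\<Lambda> \<tau>)"
    and more_cores: "\<And>n n' ts. S n ts \<Longrightarrow> n \<le> n' \<Longrightarrow> S n' ts"
  shows "test_dominates (long_paths_test \<Lambda> S M) (original_test S M)"
  unfolding test_dominates_def long_paths_test_def original_test_def
proof (intro allI impI)
  fix ts :: "'v dag_task list"
  assume "\<forall>\<tau>\<in>set ts. valid_task \<tau>" and "federated_test graham_cores S M ts"
  then show "federated_test (\<lambda>\<tau>. long_paths_cores \<tau> (\<Lambda> \<tau>)) S M ts"
    using paths long_paths_cores_le_graham_cores more_cores
    by (elim federated_test_mono) blast+
qed

end
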